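(* Let $P$ be a FASP program and let $\mathbb{LF}(P)$ be the set of all loop formulas of $P$, i.e. the set of loop formulas $\mathbb{LF}(L,P)$ for all loops $L$ of $P$. Then for any interpretation $I$ of $P$: if $I\models\mathbb{LF}(P)\cup comp(P)$, where $comp(P)$ is the completion of $P$, then $I$ is an answer set of $P$.
   Context: "Increasing" and "decreasing" are meant in the non-strict sense. A t-norm is an increasing, commutative, associative map $\mathcal{T}:[0,1]^2\to[0,1]$ with $\mathcal{T}(1,x)=x$ for all $x$; all t-norms are assumed left-continuous. The residual implicator of $\mathcal{T}$ is $\mathcal{I}(x,y)=\sup\{\lambda\in[0,1]\mid \mathcal{T}(x,\lambda)\le y\}$, and its biresiduum is $x\approx y=\mathcal{T}(\mathcal{I}(x,y),\mathcal{I}(y,x))$. A negator is a decreasing map $\mathcal{N}:[0,1]\to[0,1]$ with $\mathcal{N}(0)=1$, $\mathcal{N}(1)=0$. FASP programs. A literal is either an atom or a constant from $[0,1]$. An extended literal is either a literal (positive extended literal) or an expression $\mathcal{N}(a)$ with $a$ an atom and $\mathcal{N}$ an arbitrary negator (negative extended literal). A rule $r$ has the form $a\leftarrow \mathcal{T}(b_1,\ldots,b_n)$ with $n>0$, $a$ a literal (the head $H(r)$), $b_1,\ldots,b_n$ extended literals (forming the body $B(r)$) and $\mathcal{T}$ an arbitrary t-norm, where $\mathcal{T}(b)=b$ and $\mathcal{T}(b_1,\ldots,b_n)=\mathcal{T}(b_1,\mathcal{T}(b_2,\ldots))$. The t-norm and the negators may differ from rule to rule. $Lit^+(B(r))$ is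 the set of positive extended literals in the body of $r$, and $\mathcal{I}_r$ is the residual implicator of the t-norm in the body of $r$. A FASP program $P$ is a finite set of rules; $\mathcal{B}_P$ is the finite set of all atoms occurring in $P$; for an atom $a$, $P_a$ is the set of rules of $P$ with head $a$. Interpretations. An interpretation $I$ of $P$ is a map $I:\mathcal{B}_P\to[0,1]$, extended by $I(c)=c$ for $c\in[0,1]$, $I(\mathcal{N}(a))=\mathcal{N}(I(a))$, $I(B(r))=\mathcal{T}(I(b_1),\ldots,I(b_n))$ and $I(r)=\mathcal{I}_r(I(B(r)),I(H(r)))$ for a rule $r: a\leftarrow\mathcal{T}(b_1,\ldots,b_n)$. $I$ is a model of $P$ iff $I(r)=1$ for every $r\in P$. The support is $supp(I)=\{a\in\mathcal{B}_P\mid I(a)>0\}$. Answer sets. A set $U\subseteq\mathcal{B}_P$ is unfounded w.r.t. $I$ iff for each $u\in U$ and each $r\in P_u$ at least one of the following holds: (1) $U\cap Lit^+(B(r))\ne\emptyset$; (2) $I(u)>I(B(r))$; (3) $I(B(r))=0$. $I$ is unfounded-free iff $supp(I)\cap U=\emptyset$ for every set $U$ unfounded w.r.t. $I$. An answer set of $P$ is a model of $P$ that is unfounded-free. Completion. Interpretations are extended truth-functionally to fuzzy formulas built from atoms, constants and connectives; $I\models F$ iff $I(F)=1$, and $I\models\Theta$ for a set $\Theta$ iff $I\models F$ for all $F\in\Theta$. The completion $comp(P)$ is the set of formulas $$\{a\approx \max\{B(r)\mid r\in P_a\}\mid a\in\mathcal{B}_P\}\cup\{\mathcal{I}_r(B(r),H(r))\mid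 r\in P,\ H(r)\in[0,1]\},$$ where $\approx$ is the biresiduum of an arbitrary residual implicator, $B(r)$ as a formula denotes $\mathcal{T}(b_1,\ldots,b_n)$, and $\max\emptyset=0$. Loops and loop formulas. The positive dependency graph of $P$ is the directed graph $G_P$ on $\mathcal{B}_P$ with an edge $(a,b)$ iff there is $r\in P_a$ with $b\in Lit^+(B(r))$. A non-empty set $L\subseteq\mathcal{B}_P$ is a loop of $P$ iff for all $a,b\in L$ there is a path of length $>0$ from $a$ to $b$ in $G_P$ all of whose vertices lie in $L$. For a loop $L=\{l_1,\ldots,l_m\}$ let $R^-_P(L)=\{r\in P\mid H(r)\in L,\ Lit^+(B(r))\cap L=\emptyset\}=\{r_1,\ldots,r_n\}$. The loop formula $\mathbb{LF}(L,P)$ is $\mathcal{I}(\max(l_1,\ldots,l_m),\max(B(r_1),\ldots,B(r_n)))$, where $\mathcal{I}$ is an arbitrary residual implicator; if $R^-_P(L)=\emptyset$ it is $\mathcal{I}(\max(l_1,\ldots,l_m),0)$. *)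

theory Defs
  imports Complex_Main "HOL-Library.FuncSet" "HOL-Library.FSet"
begin

text \<open>
  Connectives on the unit interval are real functions, and their axioms only constrain
  arguments in \<open>{0..1}\<close>.
\<close>

definition t_norm :: "(real \<Rightarrow> real \<Rightarrow> real) \<Rightarrow> bool" where
  "t_norm T \<longleftrightarrow>
     (\<forall>x\<in>{0..1}. \<forall>y\<in>{0..1}. T x y \<in> {0..1}) \<and>
     (\<forall>x\<in>{0..1}. \<forall>x'\<in>{0..1}. \<forall>y\<in>{0..1}. \<forall>y'\<in>{0..1}.
        x \<le> x' \<longrightarrow> y \<le> y' \<longrightarrow> T x y \<le> T x' y') \<and>
     (\<forall>x\<in>{0..1}. \<forall>y\<in>{0..1}. T x y = T y x) \<and>
     (\<forall>x\<in>{0..1}. \<forall>y\<in>{0..1}. \<forall>z\<in>{0..1}. T x (T y z) = T (T x y) z) \<and>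
     (\<forall>x\<in>{0..1}. T 1 x = x)"

text \<open>
  Left-continuity of the partial maps; by commutativity it suffices to ask for it in the
  second argument. At the left endpoint 0 of the domain the condition is void.
\<close>

definition lc_t_norm :: "(real \<Rightarrow> real \<Rightarrow> real) \<Rightarrow> bool" where
  "lc_t_norm T \<longleftrightarrow>
     t_norm T \<and> (\<forall>x\<in>{0..1}. \<forall>y\<in>{0<..1}. continuous (at_left y) (T x))"

definition residual :: "(real \<Rightarrow> real \<Rightarrow> real) \<Rightarrow> real \<Rightarrow> real \<Rightarrow> real" where
  "residual T x y = Sup {l \<in> {0..1}. T x l \<le> y}"

definition biresiduum :: "(real \<Rightarrow> real \<Rightarrow> real) \<Rightarrow> real \<Rightarrow> real \<Rightarrow> real" where
  "biresiduum T x y = T (residual T x y) (residual T y x)"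

definition negator :: "(real \<Rightarrow> real) \<Rightarrow> bool" where
  "negator N \<longleftrightarrow> N \<in> {0..1} \<rightarrow> {0..1} \<and> antimono_on {0..1} N \<and> N 0 = 1 \<and> N 1 = 0"

text \<open>The value on the empty list is never used: rule bodies are required to be nonempty.\<close>

fun t_norm_list :: "(real \<Rightarrow> real \<Rightarrow> real) \<Rightarrow> real list \<Rightarrow> real" where
  "t_norm_list T [] = 1"
| "t_norm_list T [x] = x"
| "t_norm_list T (x # y # zs) = T x (t_norm_list T (y # zs))"


datatype 'a literal = Atom 'a | Const real

datatype 'a ext_literal = Pos "'a literal" | Neg "real \<Rightarrow> real" 'a

datatype 'a rule =
  Rule (head: "'a literal") (rule_t_norm: "real \<Rightarrow> real \<Rightarrow> real") (body: "'a ext_literal list")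

fun wf_literal :: "'a literal \<Rightarrow> bool" where
  "wf_literal (Atom a) \<longleftrightarrow> True"
| "wf_literal (Const c) \<longleftrightarrow> c \<in> {0..1}"

fun wf_ext_literal :: "'a ext_literal \<Rightarrow> bool" where
  "wf_ext_literal (Pos l) \<longleftrightarrow> wf_literal l"
| "wf_ext_literal (Neg N a) \<longleftrightarrow> negator N"

definition wf_rule :: "'a rule \<Rightarrow> bool" where
  "wf_rule r \<longleftrightarrow>
     wf_literal (head r) \<and> lc_t_norm (rule_t_norm r) \<and>
     body r \<noteq> [] \<and> (\<forall>b\<in>set (body r). wf_ext_literal b)"

definition fasp_program :: "'a rule set \<Rightarrow> bool" where
  "fasp_program P \<longleftrightarrow> finite P \<and> (\<forall>r\<in>P. wf_rule r)"

text \<open>The set functions generated by the datatypes collect exactly the occurring atoms.\<close>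

definition atoms :: "'a rule set \<Rightarrow> 'a set" where
  "atoms P = (\<Union>r\<in>P. set_rule r)"

definition rules_for :: "'a rule set \<Rightarrow> 'a \<Rightarrow> 'a rule set" where
  "rules_for P a = {r \<in> P. head r = Atom a}"

definition lit_pos :: "'a rule \<Rightarrow> 'a literal set" where
  "lit_pos r = {l. Pos l \<in> set (body r)}"


definition interpretation_of :: "'a rule set \<Rightarrow> ('a \<Rightarrow> real) \<Rightarrow> bool" where
  "interpretation_of P I \<longleftrightarrow> I \<in> atoms P \<rightarrow> {0..1}"

fun eval_literal :: "('a \<Rightarrow> real) \<Rightarrow> 'a literal \<Rightarrow> real" where
  "eval_literal I (Atom a) = I a"
| "eval_literal I (Const c) = c"

fun eval_ext_literal :: "('a \<Rightarrow> real) \<Rightarrow> 'a ext_literal \<Rightarrow> real" where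
  "eval_ext_literal I (Pos l) = eval_literal I l"
| "eval_ext_literal I (Neg N a) = N (I a)"

definition eval_body :: "('a \<Rightarrow> real) \<Rightarrow> 'a rule \<Rightarrow> real" where
  "eval_body I r = t_norm_list (rule_t_norm r) (map (eval_ext_literal I) (body r))"

definition eval_rule :: "('a \<Rightarrow> real) \<Rightarrow> 'a rule \<Rightarrow> real" where
  "eval_rule I r = residual (rule_t_norm r) (eval_body I r) (eval_literal I (head r))"

definition model_of :: "'a rule set \<Rightarrow> ('a \<Rightarrow> real) \<Rightarrow> bool" where
  "model_of P I \<longleftrightarrow> interpretation_of P I \<and> (\<forall>r\<in>P. eval_rule I r = 1)"

definition supp :: "'a rule set \<Rightarrow> ('a \<Rightarrow> real) \<Rightarrow> 'a set" where
  "supp P I = {a \<in> atoms P. I a > 0}"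

definition unfounded :: "'a rule set \<Rightarrow> ('a \<Rightarrow> real) \<Rightarrow> 'a set \<Rightarrow> bool" where
  "unfounded P I U \<longleftrightarrow>
     U \<subseteq> atoms P \<and>
     (\<forall>u\<in>U. \<forall>r\<in>rules_for P u.
        Atom ` U \<inter> lit_pos r \<noteq> {} \<or> I u > eval_body I r \<or> eval_body I r = 0)"

definition unfounded_free :: "'a rule set \<Rightarrow> ('a \<Rightarrow> real) \<Rightarrow> bool" where
  "unfounded_free P I \<longleftrightarrow> (\<forall>U. unfounded P I U \<longrightarrow> supp P I \<inter> U = {})"

definition answer_set :: "'a rule set \<Rightarrow> ('a \<Rightarrow> real) \<Rightarrow> bool" where
  "answer_set P I \<longleftrightarrow> model_of P I \<and> unfounded_free P I"


text \<open>
  \<open>FImp T\<close> and \<open>FBires T\<close> stand for the residual implicator and the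
  biresiduum of \<open>T\<close>.
\<close>

datatype 'a formula =
    FLit "'a literal"
  | FNeg "real \<Rightarrow> real" "'a formula"
  | FConj "real \<Rightarrow> real \<Rightarrow> real" "'a formula list"
  | FMax "'a formula fset"
  | FImp "real \<Rightarrow> real \<Rightarrow> real" "'a formula" "'a formula"
  | FBires "real \<Rightarrow> real \<Rightarrow> real" "'a formula" "'a formula"

primrec eval_formula :: "('a \<Rightarrow> real) \<Rightarrow> 'a formula \<Rightarrow> real" where
  "eval_formula I (FLit l) = eval_literal I l"
| "eval_formula I (FNeg N F) = N (eval_formula I F)"
| "eval_formula I (FConj T Fs) = t_norm_list T (map (eval_formula I) Fs)"
| "eval_formula I (FMax S) =
     (if S = {||} then 0 else Max (fset (eval_formula I |`| S)))"
| "eval_formula I (FImp T F G) = residual T (eval_formula I F) (eval_formula I G)"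
| "eval_formula I (FBires T F G) = biresiduum T (eval_formula I F) (eval_formula I G)"

definition satisfies :: "('a \<Rightarrow> real) \<Rightarrow> 'a formula set \<Rightarrow> bool" where
  "satisfies I Th \<longleftrightarrow> (\<forall>F\<in>Th. eval_formula I F = 1)"

text \<open>Only meaningful for finite sets; below the sets are finite because programs are.\<close>

definition max_formula :: "'a formula set \<Rightarrow> 'a formula" where
  "max_formula S = FMax (Abs_fset S)"

fun ext_literal_formula :: "'a ext_literal \<Rightarrow> 'a formula" where
  "ext_literal_formula (Pos l) = FLit l"
| "ext_literal_formula (Neg N a) = FNeg N (FLit (Atom a))"

definition body_formula :: "'a rule \<Rightarrow> 'a formula" where
  "body_formula r = FConj (rule_t_norm r) (map ext_literal_formula (body r))"

text \<open>
  The biresiduum is arbitrary: \<open>TC a\<close> is the t-norm whose biresiduum occurs in the formula for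
  the atom \<open>a\<close>. A constant function \<open>TC\<close> yields one biresiduum for the whole completion.
\<close>

definition completion :: "('a \<Rightarrow> real \<Rightarrow> real \<Rightarrow> real) \<Rightarrow> 'a rule set \<Rightarrow> 'a formula set" where
  "completion TC P =
     {FBires (TC a) (FLit (Atom a)) (max_formula (body_formula ` rules_for P a)) |a. a \<in> atoms P} \<union>
     {FImp (rule_t_norm r) (body_formula r) (FLit (head r)) |r.
        r \<in> P \<and> (\<exists>c\<in>{0..1}. head r = Const c)}"

definition dep_graph :: "'a rule set \<Rightarrow> ('a \<times> 'a) set" where
  "dep_graph P = {(a, b). \<exists>r\<in>rules_for P a. Atom b \<in> lit_pos r}"

definition is_loop :: "'a rule set \<Rightarrow> 'a set \<Rightarrow> bool" where
  "is_loop P L \<longleftrightarrow>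
     L \<noteq> {} \<and> L \<subseteq> atoms P \<and> (\<forall>a\<in>L. \<forall>b\<in>L. (a, b) \<in> (dep_graph P \<inter> L \<times> L)\<^sup>+)"

definition external_rules :: "'a rule set \<Rightarrow> 'a set \<Rightarrow> 'a rule set" where
  "external_rules P L = {r \<in> P. head r \<in> Atom ` L \<and> lit_pos r \<inter> Atom ` L = {}}"

definition loop_formula ::
    "(real \<Rightarrow> real \<Rightarrow> real) \<Rightarrow> 'a rule set \<Rightarrow> 'a set \<Rightarrow> 'a formula" where
  "loop_formula T P L =
     FImp T (max_formula ((\<lambda>l. FLit (Atom l)) ` L))
       (if external_rules P L = {} then FLit (Const 0)
        else max_formula (body_formula ` external_rules P L))"

text \<open>As for the completion, the implicator is arbitrary and may be chosen for each loop.\<close>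

definition loop_formulas ::
    "('a set \<Rightarrow> real \<Rightarrow> real \<Rightarrow> real) \<Rightarrow> 'a rule set \<Rightarrow> 'a formula set" where
  "loop_formulas TL P = {loop_formula (TL L) P L |L. is_loop P L}"

lemma atoms_iff:
  "a \<in> atoms P \<longleftrightarrow>
     (\<exists>r\<in>P. head r = Atom a \<or> Pos (Atom a) \<in> set (body r) \<or> (\<exists>N. Neg N a \<in> set (body r)))"
proof -
  have lit: "a \<in> set_literal l \<longleftrightarrow> l = Atom a" for l :: "'a literal"
    by (cases l) auto
  have ext: "a \<in> set_ext_literal b \<longleftrightarrow> b = Pos (Atom a) \<or> (\<exists>N. b = Neg N a)"
    for b :: "'a ext_literal"
    by (cases b) (auto simp: lit)
  have "a \<in> set_rule r \<longleftrightarrow>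
      head r = Atom a \<or> Pos (Atom a) \<in> set (body r) \<or> (\<exists>N. Neg N a \<in> set (body r))"
    for r :: "'a rule"
    by (cases r) (auto simp: lit ext)
  then show ?thesis
    by (auto simp: atoms_def)
qed

lemma finite_atoms: "finite P \<Longrightarrow> finite (atoms P)"
proof -
  have lit: "finite (set_literal l)" for l :: "'a literal" by (cases l) auto
  have ext: "finite (set_ext_literal b)" for b :: "'a ext_literal"
    by (cases b) (auto simp: lit)
  have "finite (set_rule r)" for r :: "'a rule" by (cases r) (auto simp: lit ext)
  then show "finite P \<Longrightarrow> finite (atoms P)" by (auto simp: atoms_def)
qed

lemma eval_body_formula: "eval_formula I (body_formula r) = eval_body I r"
proof -
  have "eval_formula I (ext_literal_formula b) = eval_ext_literal I b" for b
    by (cases b) auto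
  then show ?thesis
    by (simp add: body_formula_def eval_body_def comp_def)
qed

lemma eval_max_formula:
  assumes "finite S"
  shows "eval_formula I (max_formula S) = (if S = {} then 0 else Max (eval_formula I ` S))"
  using assms
  by (simp add: max_formula_def Abs_fset_inverse flip: fset_inject)

end

theory Submission
  imports Defs
begin

text \<open>
  The completion makes the value of an atom the maximum of the values of its rule bodies. If an
  unfounded set \<open>U\<close> meets the support, let \<open>W\<close> be the set of atoms of \<open>U\<close> on which \<open>I\<close> attains
  its maximum \<open>M > 0\<close> over \<open>U\<close>. A rule with head in \<open>W\<close> whose body has value at least \<open>M\<close> must
  have a positive body atom in \<open>U\<close>, and as t-norms lie below the minimum this atom is in \<open>W\<close>
  again. Hence every atom of \<open>W\<close> has a successor in \<open>W\<close>, and a terminal strongly connected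
  component \<open>L\<close> of \<open>W\<close> is a loop. The bodies of the external rules of \<open>L\<close> have values below
  \<open>M\<close>, contrary to the loop formula of \<open>L\<close>.
\<close>

section \<open>T-norms and residual implicators on the unit interval\<close>

lemma t_norm_in_unit:
  assumes "t_norm T" "x \<in> {0..1}" "y \<in> {0..1}"
  shows "T x y \<in> {0..1}"
  using assms unfolding t_norm_def by blast

lemma t_norm_mono:
  assumes "t_norm T" "x \<in> {0..1}" "x' \<in> {0..1}" "y \<in> {0..1}" "y' \<in> {0..1}" "x \<le> x'" "y \<le> y'"
  shows "T x y \<le> T x' y'"
  using assms unfolding t_norm_def by blast

lemma t_norm_one_left: "t_norm T \<Longrightarrow> x \<in> {0..1} \<Longrightarrow> T 1 x = x"
  unfolding t_norm_def by blast

lemma t_norm_one_right: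
  assumes "t_norm T" "x \<in> {0..1}"
  shows "T x 1 = x"
proof -
  have "T x 1 = T 1 x"
    using assms unfolding t_norm_def by (meson atLeastAtMost_iff order_refl zero_le_one)
  then show ?thesis using assms by (simp add: t_norm_one_left)
qed

lemma t_norm_le_left:
  assumes "t_norm T" "x \<in> {0..1}" "y \<in> {0..1}"
  shows "T x y \<le> x"
  using t_norm_mono[OF assms(1,2,2,3), of 1] assms by (simp add: t_norm_one_right)

lemma t_norm_le_right:
  assumes "t_norm T" "x \<in> {0..1}" "y \<in> {0..1}"
  shows "T x y \<le> y"
  using t_norm_mono[OF assms(1,2) _ assms(3,3), of 1] assms by (simp add: t_norm_one_left)

lemma t_norm_list_in_unit:
  assumes "t_norm T" "set xs \<subseteq> {0..1}"
  shows "t_norm_list T xs \<in> {0..1}"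
  using assms
proof (induction T xs rule: t_norm_list.induct)
  case (3 T x y zs)
  then show ?case using t_norm_in_unit[of T x "t_norm_list T (y # zs)"] by auto
qed auto

lemma t_norm_list_le_member:
  assumes "t_norm T" "set xs \<subseteq> {0..1}" "x \<in> set xs"
  shows "t_norm_list T xs \<le> x"
  using assms
proof (induction T xs rule: t_norm_list.induct)
  case (3 T a b cs)
  let ?t = "t_norm_list T (b # cs)"
  have unit: "a \<in> {0..1}" "?t \<in> {0..1}"
    using 3 t_norm_list_in_unit[of T "b # cs"] by auto
  show ?case
  proof (cases "x = a")
    case True
    then show ?thesis using t_norm_le_left[OF "3.prems"(1) unit] by simp
  next
    case False
    then have "?t \<le> x" using 3 by auto
    then show ?thesis using t_norm_le_right[OF "3.prems"(1) unit] by simp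
  qed
qed auto

lemma residual_eq_one_if_le:
  assumes "t_norm T" "x \<in> {0..1}" "x \<le> y"
  shows "residual T x y = 1"
proof -
  have "{l \<in> {0..1}. T x l \<le> y} = {0..1}"
    using t_norm_le_left[OF assms(1,2)] assms(3) by fastforce
  then show ?thesis by (simp add: residual_def)
qed

lemma residual_in_unit:
  assumes "t_norm T" "x \<in> {0..1}" "y \<in> {0..1}"
  shows "residual T x y \<in> {0..1}"
proof -
  \<comment> \<open>The element 0 keeps the set nonempty, so that \<open>Sup\<close> is a genuine
    supremum.\<close>
  have "T x 0 \<le> 0" using t_norm_le_right[OF assms(1,2), of 0] by simp
  then have "0 \<in> {l \<in> {0..1}. T x l \<le> y}" using assms(3) by simp
  then show ?thesis unfolding residual_def
    by (auto intro!: cSup_upper cSup_least bdd_aboveI[of _ 1])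
qed

text \<open>The supremum 1 need not be attained a priori, but \<open>T x l \<le> y\<close> holds for
  every \<open>l\<close> strictly between 0 and 1, and left-continuity at 1 carries the bound over
  to \<open>T x 1\<close>, which is \<open>x\<close>.\<close>

lemma le_if_residual_eq_one:
  assumes "lc_t_norm T" "x \<in> {0..1}" "y \<in> {0..1}" "residual T x y = 1"
  shows "x \<le> y"
proof -
  have T: "t_norm T" and "continuous (at_left 1) (T x)"
    using assms(1,2) by (auto simp: lc_t_norm_def)
  then have lim: "(T x \<longlongrightarrow> x) (at_left 1)"
    using t_norm_one_right[OF T assms(2)] by (simp add: continuous_within)
  have zero: "T x 0 \<le> y" using t_norm_le_right[OF T assms(2), of 0] assms(3) by simp
  have "T x l \<le> y" if "0 < l" "l < 1" for l
  proof -
    \<comment> \<open>Any \<open>l\<close> below the supremum is exceeded by a member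
      \<open>m\<close> of the set; monotonicity brings the bound at \<open>m\<close> down to
      \<open>l\<close>.\<close>
    have "\<exists>m\<in>{l \<in> {0..1}. T x l \<le> y}. l < m"
    proof (rule less_cSupD)
      show "{l \<in> {0..1}. T x l \<le> y} \<noteq> {}" using zero by force
      show "l < Sup {l \<in> {0..1}. T x l \<le> y}"
        using assms(4) that by (simp add: residual_def)
    qed
    then obtain m where "m \<in> {0..1}" "T x m \<le> y" "l < m" by blast
    then show ?thesis using t_norm_mono[OF T assms(2,2), of l m] that by force
  qed
  then have "eventually (\<lambda>l. T x l \<le> y) (at_left 1)"
    by (auto simp: eventually_at_left_field intro!: exI[of _ 0])
  with lim show ?thesis by (rule tendsto_upperbound) simp
qed

text \<open>A t-norm lies below both arguments, so the value 1 forces both residua to be 1, and each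
  yields one inequality.\<close>

lemma eq_if_biresiduum_eq_one:
  assumes "lc_t_norm T" "x \<in> {0..1}" "y \<in> {0..1}" "biresiduum T x y = 1"
  shows "x = y"
proof -
  have T: "t_norm T" using assms(1) by (simp add: lc_t_norm_def)
  let ?a = "residual T x y" and ?b = "residual T y x"
  have unit: "?a \<in> {0..1}" "?b \<in> {0..1}"
    using residual_in_unit[OF T] assms by blast+
  have "?a = 1" "?b = 1"
    using t_norm_le_left[OF T unit] t_norm_le_right[OF T unit] unit assms(4)
    by (auto simp: biresiduum_def)
  then show ?thesis
    using le_if_residual_eq_one[OF assms(1)] assms(2,3) by (meson order_antisym)
qed

section \<open>Values of literals and rule bodies\<close>

lemma eval_ext_literal_in_unit:
  assumes "fasp_program P" "interpretation_of P I" "r \<in> P" "b \<in> set (body r)"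
  shows "eval_ext_literal I b \<in> {0..1}"
proof -
  have wf: "wf_ext_literal b" using assms by (auto simp: fasp_program_def wf_rule_def)
  have atom: "I a \<in> {0..1}" if "b = Pos (Atom a) \<or> (\<exists>N. b = Neg N a)" for a
  proof -
    have "a \<in> atoms P" using that assms(3,4) by (auto simp: atoms_iff)
    then show ?thesis using assms(2) by (auto simp: interpretation_of_def)
  qed
  show ?thesis
  proof (cases b)
    case (Pos l)
    then show ?thesis using wf atom by (cases l) auto
  next
    case (Neg N a)
    then show ?thesis using wf atom[of a] by (auto simp: negator_def Pi_iff)
  qed
qed

lemma eval_body_in_unit:
  assumes "fasp_program P" "interpretation_of P I" "r \<in> P"
  shows "eval_body I r \<in> {0..1}"
  unfolding eval_body_def
proof (rule t_norm_list_in_unit)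
  show "t_norm (rule_t_norm r)"
    using assms by (simp add: fasp_program_def wf_rule_def lc_t_norm_def)
  show "set (map (eval_ext_literal I) (body r)) \<subseteq> {0..1}"
    using eval_ext_literal_in_unit[OF assms] by auto
qed

text \<open>T-norms lie below each argument. This passes a large body value on to the positive atoms
  of the body.\<close>

lemma eval_body_le_atom:
  assumes "fasp_program P" "interpretation_of P I" "r \<in> P" "Atom b \<in> lit_pos r"
  shows "eval_body I r \<le> I b"
  unfolding eval_body_def
proof (rule t_norm_list_le_member)
  show "t_norm (rule_t_norm r)"
    using assms by (simp add: fasp_program_def wf_rule_def lc_t_norm_def)
  show "set (map (eval_ext_literal I) (body r)) \<subseteq> {0..1}"
    using eval_ext_literal_in_unit[OF assms(1-3)] by auto
  show "I b \<in> set (map (eval_ext_literal I) (body r))"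
    using assms(4) by (force simp: lit_pos_def)
qed

section \<open>Consequences of the completion\<close>

lemma eval_max_body_formula:
  assumes "finite R"
  shows "eval_formula I (max_formula (body_formula ` R)) =
    (if R = {} then 0 else Max (eval_body I ` R))"
  using assms by (simp add: eval_max_formula image_image eval_body_formula)

text \<open>A biresiduum with value 1 is an equality, whichever left-continuous t-norm it comes
  from.\<close>

lemma completion_atom_value:
  assumes "fasp_program P" "interpretation_of P I" "lc_t_norm (TC a)"
    "satisfies I (completion TC P)" "a \<in> atoms P"
  shows "I a = (if rules_for P a = {} then 0 else Max (eval_body I ` rules_for P a))"
    (is "_ = ?m")
proof -
  have fin: "finite (rules_for P a)"
    using assms(1) by (simp add: fasp_program_def rules_for_def)
  have "?m \<in> eval_body I ` rules_for P a" if "rules_for P a \<noteq> {}"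
    using Max_in[of "eval_body I ` rules_for P a"] fin that by simp
  then have unit: "?m \<in> {0..1}"
    using eval_body_in_unit[OF assms(1,2)] by (fastforce simp: rules_for_def)
  have "eval_formula I
      (FBires (TC a) (FLit (Atom a)) (max_formula (body_formula ` rules_for P a))) = 1"
    using assms(4,5) unfolding satisfies_def completion_def by blast
  then have "biresiduum (TC a) (I a) ?m = 1"
    using fin by (simp add: eval_max_body_formula)
  moreover have "I a \<in> {0..1}" using assms(2,5) by (auto simp: interpretation_of_def)
  ultimately show ?thesis using eq_if_biresiduum_eq_one[OF assms(3) _ unit] by blast
qed

text \<open>The value of an atomic head is the maximum over its rules and dominates each body, which
  makes the residuum 1. For a constant head the completion contains the rule itself as a
  formula.\<close>

lemma model_of_if_completion:
  assumes P: "fasp_program P" and I: "interpretation_of P I"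
    and TC: "\<And>a. a \<in> atoms P \<Longrightarrow> lc_t_norm (TC a)"
    and comp: "satisfies I (completion TC P)"
  shows "model_of P I"
  unfolding model_of_def
proof (intro conjI ballI)
  fix r assume r: "r \<in> P"
  have wf: "wf_rule r" using P r by (simp add: fasp_program_def)
  show "eval_rule I r = 1"
  proof (cases "head r")
    case (Atom a)
    have a: "a \<in> atoms P" using r Atom by (auto simp: atoms_iff)
    have ra: "r \<in> rules_for P a" using r Atom by (simp add: rules_for_def)
    have "finite (rules_for P a)" using P by (simp add: fasp_program_def rules_for_def)
    then have "eval_body I r \<le> I a"
      using completion_atom_value[OF P I TC[OF a] comp a] ra by (auto intro: Max_ge)
    then show ?thesis
      using wf Atom residual_eq_one_if_le[OF _ eval_body_in_unit[OF P I r]]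
      by (simp add: eval_rule_def wf_rule_def lc_t_norm_def)
  next
    case (Const c)
    then have "c \<in> {0..1}" using wf by (simp add: wf_rule_def)
    then have "FImp (rule_t_norm r) (body_formula r) (FLit (head r)) \<in> completion TC P"
      using r Const unfolding completion_def by blast
    then have "eval_formula I (FImp (rule_t_norm r) (body_formula r) (FLit (head r))) = 1"
      using comp unfolding satisfies_def by blast
    then show ?thesis by (simp add: eval_rule_def eval_body_formula)
  qed
qed (rule I)

section \<open>Terminal strongly connected components\<close>

text \<open>Let \<open>L\<close> be the set reachable from a vertex \<open>u\<close> whose reachable
  set has least cardinality. Any \<open>v\<close> in \<open>L\<close> reaches only vertices of
  \<open>L\<close>, hence by minimality all of them.\<close>

lemma terminal_strongly_connected:
  assumes "finite W" "W \<noteq> {}" and succ: "\<And>u. u \<in> W \<Longrightarrow> \<exists>v\<in>W. (u, v) \<in> E"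
  obtains L where "L \<noteq> {}" "L \<subseteq> W"
    "\<And>a b. a \<in> L \<Longrightarrow> b \<in> L \<Longrightarrow> (a, b) \<in> (E \<inter> L \<times> L)\<^sup>+"
    "\<And>a b. a \<in> L \<Longrightarrow> b \<in> W \<Longrightarrow> (a, b) \<in> E \<Longrightarrow> b \<in> L"
proof -
  \<comment> \<open>Restriction to \<open>W\<close> keeps all reachable sets finite, so their
    cardinalities can be compared.\<close>
  define G where "G = E \<inter> W \<times> W"
  have sub: "G\<^sup>+ `` {u} \<subseteq> W" for u
    using trancl_subset_Sigma[of G W] by (auto simp: G_def)
  obtain u where u: "u \<in> W" and least: "\<And>v. v \<in> W \<Longrightarrow> card (G\<^sup>+ `` {u}) \<le> card (G\<^sup>+ `` {v})"
    using ex_is_arg_min_if_finite[OF assms(1,2), of "\<lambda>u. card (G\<^sup>+ `` {u})"]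
    by (auto simp: is_arg_min_linorder)
  define L where "L = G\<^sup>+ `` {u}"
  have L: "L \<subseteq> W" using sub by (simp add: L_def)
  have whole: "G\<^sup>+ `` {v} = L" if "v \<in> L" for v
  proof (rule card_seteq)
    show "finite L" using L assms(1) by (rule finite_subset)
    show "G\<^sup>+ `` {v} \<subseteq> L" using that by (auto simp: L_def intro: trancl_trans)
    show "card L \<le> card (G\<^sup>+ `` {v})" using least L that by (auto simp: L_def)
  qed
  have closed: "b \<in> L" if "a \<in> L" "b \<in> W" "(a, b) \<in> E" for a b
    using that L whole[OF that(1)] by (auto simp: G_def)
  \<comment> \<open>\<open>G\<close> only keeps paths inside \<open>W\<close>, whereas a loop needs
    them inside \<open>L\<close>. A path that starts in \<open>L\<close> cannot leave it, by
    \<open>closed\<close>.\<close>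
  have path: "(a, b) \<in> (E \<inter> L \<times> L)\<^sup>+" if "a \<in> L" "(a, b) \<in> G\<^sup>+" for a b
    using that(2)
  proof (induction rule: trancl_induct)
    case (base y)
    then show ?case using that(1) closed by (auto simp: G_def)
  next
    case (step y z)
    have "y \<in> L" using whole[OF that(1)] step.hyps(1) by blast
    then have "(y, z) \<in> E \<inter> L \<times> L" using step.hyps(2) closed by (auto simp: G_def)
    with step.IH show ?case by (rule trancl_into_trancl)
  qed
  show thesis
  proof
    \<comment> \<open>Reachability is by paths of positive length, so \<open>u\<close> itself need
      not lie in \<open>L\<close>, but its successor does.\<close>
    show "L \<noteq> {}" using succ[OF u] u by (auto simp: L_def G_def)
    show "(a, b) \<in> (E \<inter> L \<times> L)\<^sup>+" if "a \<in> L" "b \<in> L" for a b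
      using path whole that by blast
  qed (use L closed in auto)
qed

section \<open>Loop formulas and unfounded sets\<close>

text \<open>A residuum with value 1 is an inequality once both sides are known to lie in the unit
  interval.\<close>

lemma loop_formula_bound:
  assumes P: "fasp_program P" and I: "interpretation_of P I" and L: "is_loop P L"
    and TL: "lc_t_norm T" and LF: "eval_formula I (loop_formula T P L) = 1"
  shows "Max (I ` L) \<le>
    (if external_rules P L = {} then 0 else Max (eval_body I ` external_rules P L))"
    (is "_ \<le> ?m")
proof -
  have L': "L \<noteq> {}" "L \<subseteq> atoms P" using L by (auto simp: is_loop_def)
  have finL: "finite L" using P L'(2) by (meson fasp_program_def finite_atoms finite_subset)
  have finR: "finite (external_rules P L)"
    using P by (simp add: fasp_program_def external_rules_def)
  have "?m \<in> eval_body I ` external_rules P L" if "external_rules P L \<noteq> {}"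
    using Max_in[of "eval_body I ` external_rules P L"] finR that by simp
  then have unit: "?m \<in> {0..1}"
    using eval_body_in_unit[OF P I] by (fastforce simp: external_rules_def)
  have "Max (I ` L) \<in> I ` L" using finL L' by (intro Max_in) auto
  then have "Max (I ` L) \<in> {0..1}" using I L' by (auto simp: interpretation_of_def)
  moreover have "residual T (Max (I ` L)) ?m = 1"
    using LF finL finR L'
    by (simp add: loop_formula_def eval_max_formula image_image eval_body_formula
        split: if_splits)
  ultimately show ?thesis using le_if_residual_eq_one[OF TL _ unit] by blast
qed

text \<open>The completion enters only through \<open>supported\<close>, which gives each atom of
  \<open>W\<close> a rule with body value \<open>M\<close> and thereby a successor.\<close>

lemma unfounded_free_if_loop_formulas:
  assumes P: "fasp_program P" and I: "interpretation_of P I"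
    and supported: "\<And>a. a \<in> atoms P \<Longrightarrow> I a > 0 \<Longrightarrow> \<exists>r\<in>rules_for P a. eval_body I r = I a"
    and TL: "\<And>L. is_loop P L \<Longrightarrow> lc_t_norm (TL L)"
    and LF: "satisfies I (loop_formulas TL P)"
  shows "unfounded_free P I"
  unfolding unfounded_free_def
proof (intro allI impI, rule ccontr)
  fix U assume unf: "unfounded P I U" and ne: "supp P I \<inter> U \<noteq> {}"
  have U: "U \<subseteq> atoms P" using unf by (simp add: unfounded_def)
  have finU: "finite U" using P U by (meson fasp_program_def finite_atoms finite_subset)
  define M where "M = Max (I ` U)"
  define W where "W = {u \<in> U. I u = M}"
  have le_M: "I u \<le> M" if "u \<in> U" for u using that finU by (auto simp: M_def)
  have M_pos: "M > 0" using ne le_M by (force simp: supp_def)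
  have "M \<in> I ` U" unfolding M_def using ne finU by (intro Max_in) auto
  then have W: "W \<noteq> {}" "finite W" using finU by (auto simp: W_def)
  \<comment> \<open>The other two alternatives of unfoundedness fail: the body value is at least
    \<open>M\<close>, which is positive and equals \<open>I u\<close>. An inequality instead of an
    equality lets the claim serve for external rules too.\<close>
  have succ_in_W: "\<exists>b\<in>W. Atom b \<in> lit_pos r"
    if "u \<in> W" "r \<in> rules_for P u" "eval_body I r \<ge> M" for u r
  proof -
    have u: "u \<in> U" "I u = M" using that(1) by (auto simp: W_def)
    then have "Atom ` U \<inter> lit_pos r \<noteq> {}"
      using unf that(2,3) M_pos unfolding unfounded_def by force
    then obtain b where b: "b \<in> U" "Atom b \<in> lit_pos r" by blast
    have "eval_body I r \<le> I b"
      using that(2) b(2) by (intro eval_body_le_atom[OF P I]) (auto simp: rules_for_def)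
    then have "I b = M" using that(3) le_M[OF b(1)] by simp
    then show ?thesis using b by (auto simp: W_def)
  qed
  have "\<exists>v\<in>W. (u, v) \<in> dep_graph P" if "u \<in> W" for u
  proof -
    have "u \<in> atoms P" "I u = M" using that U by (auto simp: W_def)
    then obtain r where "r \<in> rules_for P u" "eval_body I r = M"
      using supported M_pos by metis
    then show ?thesis using succ_in_W[OF that] by (force simp: dep_graph_def)
  qed
  then obtain L where L: "L \<noteq> {}" "L \<subseteq> W"
    and conn: "\<And>a b. a \<in> L \<Longrightarrow> b \<in> L \<Longrightarrow> (a, b) \<in> (dep_graph P \<inter> L \<times> L)\<^sup>+"
    and closed: "\<And>a b. a \<in> L \<Longrightarrow> b \<in> W \<Longrightarrow> (a, b) \<in> dep_graph P \<Longrightarrow> b \<in> L"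
    using terminal_strongly_connected[OF W(2,1), of "dep_graph P"] by metis
  have loop: "is_loop P L"
    using L conn U by (auto simp: is_loop_def W_def)
  \<comment> \<open>Otherwise \<open>r\<close> would have a positive body atom in \<open>W\<close>,
    which \<open>closed\<close> would put into \<open>L\<close>, against externality.\<close>
  have small: "eval_body I r < M" if r: "r \<in> external_rules P L" for r
  proof (rule ccontr)
    assume "\<not> eval_body I r < M"
    moreover obtain u where u: "u \<in> L" "r \<in> rules_for P u"
      using r by (auto simp: external_rules_def rules_for_def)
    ultimately obtain b where b: "b \<in> W" "Atom b \<in> lit_pos r"
      using succ_in_W[of u r] L(2) by auto
    then have "b \<in> L" using closed[OF u(1) b(1)] u(2) by (auto simp: dep_graph_def)
    then show False using r b(2) by (auto simp: external_rules_def)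
  qed
  have "eval_formula I (loop_formula (TL L) P L) = 1"
    using LF loop by (auto simp: satisfies_def loop_formulas_def)
  note bound = loop_formula_bound[OF P I loop TL[OF loop] this]
  have "I ` L = {M}" using L by (auto simp: W_def)
  moreover have "finite (external_rules P L)"
    using P by (simp add: fasp_program_def external_rules_def)
  \<comment> \<open>The loop formula bounds \<open>M\<close> by 0 or by the maximum of finitely many
    values below \<open>M\<close>; the former contradicts \<open>M_pos\<close>, the latter
    \<open>small\<close>.\<close>
  ultimately show False using bound small M_pos
    by (force split: if_splits simp: Max_ge_iff)
qed

theorem proposition5:
  fixes P :: "'a rule set"
    and I :: "'a \<Rightarrow> real"
    and TC :: "'a \<Rightarrow> real \<Rightarrow> real \<Rightarrow> real"
    and TL :: "'a set \<Rightarrow> real \<Rightarrow> real \<Rightarrow> real"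
  assumes "fasp_program P"
    and "\<And>a. a \<in> atoms P \<Longrightarrow> lc_t_norm (TC a)"
    and "\<And>L. is_loop P L \<Longrightarrow> lc_t_norm (TL L)"
    and "interpretation_of P I"
    and "satisfies I (loop_formulas TL P \<union> completion TC P)"
  shows "answer_set P I"
proof -
  have LF: "satisfies I (loop_formulas TL P)" and comp: "satisfies I (completion TC P)"
    using assms(5) by (auto simp: satisfies_def)
  have "\<exists>r\<in>rules_for P a. eval_body I r = I a" if "a \<in> atoms P" "I a > 0" for a
  proof -
    have "finite (rules_for P a)" using assms(1) by (simp add: fasp_program_def rules_for_def)
    moreover note val = completion_atom_value[OF assms(1,4) assms(2)[OF that(1)] comp that(1)]
    \<comment> \<open>Without rules the maximum would be 0 by convention, against the positivity of
      \<open>I a\<close>.\<close>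
    moreover have "rules_for P a \<noteq> {}" using val that(2) by auto
    ultimately have "I a \<in> eval_body I ` rules_for P a"
      using Max_in[of "eval_body I ` rules_for P a"] by simp
    then show ?thesis by auto
  qed
  then have "unfounded_free P I"
    by (rule unfounded_free_if_loop_formulas[OF assms(1,4) _ assms(3) LF])
  then show ?thesis
    using model_of_if_completion[OF assms(1,4,2) comp] by (simp add: answer_set_def)
qed

end
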